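(* Let $\tau\in S_k(132)$ and let $\tau=(\tau^0,m_0,\tau^1,m_1,\dots,\tau^r,m_r)$ be its canonical decomposition, with prefixes $\pi^{-1},\pi^0,\dots,\pi^r$ and suffixes $\sigma^0,\dots,\sigma^{r}$ as defined in the context. Then $F_\tau(x)$ is a rational function of $x$ and $$F_\tau(x)=1+x\sum_{j=0}^r\bigl(F_{\pi^j}(x)-F_{\pi^{j-1}}(x)\bigr)F_{\sigma^j}(x).$$
   Context: A permutation $\alpha\in S_n$ contains a pattern $\tau\in S_k$ if there are indices $1\le i_1<\dots<i_k\le n$ such that $(\alpha_{i_1},\dots,\alpha_{i_k})$ is order-isomorphic to $\tau$; otherwise $\alpha$ avoids $\tau$. $S_n(T)$ denotes the set of permutations in $S_n$ avoiding every pattern in $T$ ($S_0$ consists of the empty permutation). For a pattern $\tau$, $f_\tau(n)$ is the number of permutations in $S_n$ avoiding both $132$ and $\tau$, and $F_\tau(x)=\sum_{n\ge0}f_\tau(n)x^n$. Any sequence of distinct integers is identified with the unique permutation order-isomorphic to it. Since every permutation contains the empty pattern, $F_\varnothing(x)=0$. Canonical decomposition: an entry $\tau_i$ is a right-to-left maximum if $\tau_i>\tau_j$ for all $j>i$. If $m_0=k,m_1,\dots,m_r$ are the right-to-left maxima of $\tau$ listed from left to right, then $\tau=(\tau^0,m_0,\tau^1,m_1,\dots,\tau^r,m_r)$ where the blocks $\tau^i$ are (possibly empty) consecutive segments. Prefixes: $\pi^{-1}=\varnothing$, $\pi^0=\tau^0$, and $\pi^i=(\tau^0,m_0,\dots,\tau^i,m_i)$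 for $1\le i\le r$. Suffixes: $\sigma^i=(\tau^i,m_i,\dots,\tau^r,m_r)$ for $0\le i\le r$. *)

theory Defs
  imports
    "HOL-Combinatorics.Multiset_Permutations"
    "HOL-Library.Sublist"
    "HOL-Computational_Algebra.Polynomial_FPS"
begin

text \<open>
  Permutations are written in one-line notation: an element of $S_n$ is a member of
  \<^term>\<open>permutations_of_set {1..n}\<close>, i.e. a list.
\<close>

definition order_isomorphic :: "nat list \<Rightarrow> nat list \<Rightarrow> bool" where
  "order_isomorphic xs ys \<longleftrightarrow>
     length xs = length ys \<and>
     (\<forall>i < length xs. \<forall>j < length xs. xs ! i < xs ! j \<longleftrightarrow> ys ! i < ys ! j)"

text \<open>
  The pattern may be any list of distinct numbers. It stands for the unique permutation
  order-isomorphic to it (see \<open>contains_cong\<close> and \<open>avoid_gf_cong\<close> below), so segments of a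
  permutation can be used as patterns without standardizing them.
\<close>

definition contains :: "nat list \<Rightarrow> nat list \<Rightarrow> bool" where
  "contains \<alpha> \<tau> \<longleftrightarrow> (\<exists>\<beta>. subseq \<beta> \<alpha> \<and> order_isomorphic \<beta> \<tau>)"

definition avoiders :: "nat \<Rightarrow> nat list set \<Rightarrow> nat list set" where
  "avoiders n T = {\<alpha> \<in> permutations_of_set {1..n}. \<forall>\<tau>\<in>T. \<not> contains \<alpha> \<tau>}"

definition avoid_count :: "nat list \<Rightarrow> nat \<Rightarrow> nat" where
  "avoid_count \<tau> n = card (avoiders n {[1, 3, 2], \<tau>})"

definition avoid_gf :: "nat list \<Rightarrow> rat fps" where
  "avoid_gf \<tau> = Abs_fps (\<lambda>n. of_nat (avoid_count \<tau> n))"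

definition rational_fps :: "'a::field fps \<Rightarrow> bool" where
  "rational_fps G \<longleftrightarrow> (\<exists>p q. q \<noteq> 0 \<and> fps_of_poly q * G = fps_of_poly p)"

definition rl_maxima :: "nat list \<Rightarrow> nat list" where
  "rl_maxima \<tau> =
     map ((!) \<tau>) (filter (\<lambda>i. \<forall>j. i < j \<and> j < length \<tau> \<longrightarrow> \<tau> ! i > \<tau> ! j) [0..<length \<tau>])"

text \<open>
  The segment $(b_i, m_i, \ldots, b_{j-1}, m_{j-1})$, where \<open>b i\<close> is the block that the
  literature writes as $\tau^i$.
\<close>

definition segment :: "(nat \<Rightarrow> nat list) \<Rightarrow> (nat \<Rightarrow> nat) \<Rightarrow> nat \<Rightarrow> nat \<Rightarrow> nat list" where
  "segment b m i j = concat (map (\<lambda>l. b l @ [m l]) [i..<j])"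

text \<open>
  As the entries of \<open>\<tau>\<close> are distinct, the values \<open>m i\<close> determine their positions
  and hence the blocks. Only a nonempty \<open>\<tau>\<close> has a canonical decomposition.
\<close>

definition canonical_decomposition ::
    "nat list \<Rightarrow> nat \<Rightarrow> (nat \<Rightarrow> nat list) \<Rightarrow> (nat \<Rightarrow> nat) \<Rightarrow> bool" where
  "canonical_decomposition \<tau> r b m \<longleftrightarrow>
     map m [0..<Suc r] = rl_maxima \<tau> \<and> \<tau> = segment b m 0 (Suc r)"

text \<open>The prefixes $\pi^j$ for $j \ge -1$; note that $\pi^0 = \tau^0$ does not include $m_0$.\<close>

definition pi_prefix :: "(nat \<Rightarrow> nat list) \<Rightarrow> (nat \<Rightarrow> nat) \<Rightarrow> int \<Rightarrow> nat list" where
  "pi_prefix b m j =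
     (if j < 0 then [] else if j = 0 then b 0 else segment b m 0 (Suc (nat j)))"

definition sigma_suffix ::
    "nat \<Rightarrow> (nat \<Rightarrow> nat list) \<Rightarrow> (nat \<Rightarrow> nat) \<Rightarrow> nat \<Rightarrow> nat list" where
  "sigma_suffix r b m j = segment b m j (Suc r)"

lemma contains_cong:
  assumes "order_isomorphic \<tau> \<tau>'"
  shows "contains \<alpha> \<tau> \<longleftrightarrow> contains \<alpha> \<tau>'"
  using assms unfolding contains_def order_isomorphic_def by auto

lemma avoid_gf_cong:
  assumes "order_isomorphic \<tau> \<tau>'"
  shows "avoid_gf \<tau> = avoid_gf \<tau>'"
  using contains_cong[OF assms] by (simp add: avoid_gf_def avoid_count_def avoiders_def)

lemma avoid_gf_Nil: "avoid_gf [] = 0"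
proof -
  have "contains \<alpha> []" for \<alpha>
    by (simp add: contains_def order_isomorphic_def)
  then show ?thesis by (simp add: avoid_gf_def avoid_count_def avoiders_def fps_eq_iff)
qed

lemma rl_maxima_Cons:
  "rl_maxima (x # xs) = (if \<forall>y\<in>set xs. x > y then [x] else []) @ rl_maxima xs"
proof -
  have *: "[0..<length (x # xs)] = 0 # map Suc [0..<length xs]"
    by (simp add: upt_conv_Cons map_Suc_upt del: upt_Suc)
  have 0: "(\<forall>j. 0 < j \<and> j < length (x # xs) \<longrightarrow> (x # xs) ! 0 > (x # xs) ! j) \<longleftrightarrow>
      (\<forall>y\<in>set xs. x > y)"
    by (force simp: in_set_conv_nth gr0_conv_Suc)
  have 1: "(\<forall>j. Suc i < j \<and> j < length (x # xs) \<longrightarrow> (x # xs) ! Suc i > (x # xs) ! j) \<longleftrightarrow>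
      (\<forall>j. i < j \<and> j < length xs \<longrightarrow> xs ! i > xs ! j)" for i
    by (auto simp: less_Suc_eq_0_disj all_conj_distrib nth_Cons split: nat.split)
  show ?thesis
    unfolding rl_maxima_def * filter.simps filter_map o_def 0 1 by (simp add: o_def)
qed

lemma canonical_decomposition_exists:
  assumes "\<tau> \<noteq> []"
  shows "\<exists>r b m. canonical_decomposition \<tau> r b m"
  using assms
proof (induction \<tau>)
  case (Cons x xs)
  show ?case
  proof (cases "xs = []")
    case True
    then have "canonical_decomposition (x # xs) 0 (\<lambda>_. []) (\<lambda>_. x)"
      by (simp add: canonical_decomposition_def segment_def rl_maxima_def)
    then show ?thesis by blast
  next
    case False
    with Cons.IH obtain r b m where d: "canonical_decomposition xs r b m" by blast
    show ?thesis
    proof (cases "\<forall>y\<in>set xs. x > y")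
      case True
      have u: "[0..<Suc (Suc r)] = 0 # map Suc [0..<Suc r]"
        by (simp add: upt_conv_Cons map_Suc_upt del: upt_Suc)
      have "canonical_decomposition (x # xs) (Suc r) (case_nat [] b) (case_nat x m)"
        using d True
        unfolding canonical_decomposition_def segment_def rl_maxima_Cons u
        by (simp add: o_def del: upt_Suc)
      then show ?thesis by blast
    next
      case nmax: False
      have u: "[0..<Suc r] = 0 # map Suc [0..<r]"
        by (simp add: upt_conv_Cons map_Suc_upt del: upt_Suc)
      have "canonical_decomposition (x # xs) r (b(0 := x # b 0)) m"
        using d nmax
        unfolding canonical_decomposition_def segment_def rl_maxima_Cons u
        by (simp add: o_def del: upt_Suc)
      then show ?thesis by blast
    qed
  qed
qed simp

end

theory Submission imports Defs begin

text \<open>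
  A permutation avoiding 132 has the form $(A, n, B)$ with every entry of $A$ above every entry
  of $B$. An occurrence of $\tau$ in it is cut between $A$ and $B$ into two pieces, the first above
  the second; as $\tau$ avoids 132, it can be cut this way only behind a right-to-left maximum. Hence
  $(A, n, B)$ contains $\tau$ iff for some $i \in \{0, \ldots, r + 1\}$ the part $A$ contains $\pi^{i-1}$
  and $B$ contains $\sigma^i$, where $\sigma^{r+1} = \varnothing$. That $\pi^0$ omits $m_0$ accounts
  for the entry $n$ playing the role of $m_0$.
  Since the $\pi^i$ grow and the $\sigma^i$ shrink, $(A, n, B)$ avoids $\tau$ iff for the unique $j$ such
  that $A$ avoids $\pi^j$ but contains $\pi^{j-1}$, the part $B$ avoids $\sigma^j$; counting by $j$
  gives the recurrence. As $\sigma^0 = \tau$, and $\pi^r = \tau$ for $r > 0$, the recurrence is a linear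
  equation for $F_\tau$ over shorter patterns whose leading coefficient has constant term 1, so
  rationality follows by induction on the length.
\<close>

subsection \<open>Pattern containment\<close>

text \<open>With pairs of corresponding entries in place of indices, appending becomes a union of
  sets of pairs, so order isomorphism can be checked block by block with
  \<open>ball_Un\<close>.\<close>

lemma order_isomorphic_zip:
  "order_isomorphic xs ys \<longleftrightarrow>
     length xs = length ys \<and>
     (\<forall>p\<in>set (zip xs ys). \<forall>q\<in>set (zip xs ys). fst p < fst q \<longleftrightarrow> snd p < snd q)"
proof -
  have "set (zip xs ys) = (\<lambda>i. (xs ! i, ys ! i)) ` {..<length xs}" if "length xs = length ys"
    using that by (auto simp: set_zip)
  then show ?thesis unfolding order_isomorphic_def by auto
qed

lemma order_isomorphic_length: "order_isomorphic xs ys \<Longrightarrow> length xs = length ys"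
  by (simp add: order_isomorphic_def)

lemma in_set_zipD: "p \<in> set (zip xs ys) \<Longrightarrow> fst p \<in> set xs \<and> snd p \<in> set ys"
  by (metis prod.collapse set_zip_leftD set_zip_rightD)

lemma order_isomorphic_append:
  assumes "order_isomorphic xs ys" "order_isomorphic xs' ys'"
    and "\<forall>x\<in>set xs. \<forall>x'\<in>set xs'. x' < x" "\<forall>y\<in>set ys. \<forall>y'\<in>set ys'. y' < y"
  shows "order_isomorphic (xs @ xs') (ys @ ys')"
proof -
  \<comment> \<open>A mixed pair is compared in both directions, hence the two negations.\<close>
  have "fst q < fst p \<and> snd q < snd p \<and> \<not> fst p < fst q \<and> \<not> snd p < snd q"
    if "p \<in> set (zip xs ys)" "q \<in> set (zip xs' ys')" for p q
    using in_set_zipD[OF that(1)] in_set_zipD[OF that(2)] assms(3,4) by (simp add: less_imp_le leD)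
  with assms(1,2) show ?thesis
    unfolding order_isomorphic_zip by (simp add: ball_Un)
qed

text \<open>Lets the maximum \<open>M\<close> of a permutation play the maximum of the pattern. The
  equal lengths of \<open>xs\<close> and \<open>ys\<close> put both maxima at the same
  position.\<close>

lemma order_isomorphic_insert_max:
  assumes "order_isomorphic (xs @ xs') (ys @ ys')" "length xs = length ys"
    and "\<forall>x\<in>set (xs @ xs'). x < M" "\<forall>y\<in>set (ys @ ys'). y < K"
  shows "order_isomorphic (xs @ M # xs') (ys @ K # ys')"
proof -
  have "fst p < M \<and> snd p < K \<and> \<not> M < fst p \<and> \<not> K < snd p"
    if "p \<in> set (zip xs ys) \<union> set (zip xs' ys')" for p
  proof -
    have "fst p \<in> set (xs @ xs')" "snd p \<in> set (ys @ ys')"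
      using that in_set_zipD[of p xs ys] in_set_zipD[of p xs' ys'] by auto
    with assms(3,4) show ?thesis by (meson less_asym)
  qed
  with assms(1,2) show ?thesis
    unfolding order_isomorphic_zip by (simp add: ball_Un)
qed

lemma order_isomorphic_appendD:
  assumes "order_isomorphic (xs @ xs') (ys @ ys')" "length xs = length ys"
  shows "order_isomorphic xs ys" "order_isomorphic xs' ys'"
  using assms unfolding order_isomorphic_zip by (simp_all add: ball_Un)

text \<open>Carries a cut of an occurrence, with everything before it above everything after it,
  over to the pattern, whose shape then restricts where such a cut can be.\<close>

lemma order_isomorphic_less:
  assumes "order_isomorphic (xs @ xs') (ys @ ys')" "length xs = length ys"
    and "\<forall>x\<in>set xs. \<forall>x'\<in>set xs'. x' < x"
  shows "\<forall>y\<in>set ys. \<forall>y'\<in>set ys'. y' < y"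
proof (intro ballI)
  fix y y' assume y: "y \<in> set ys" "y' \<in> set ys'"
  have "length xs' = length ys'"
    using assms(1,2) by (simp add: order_isomorphic_def)
  with assms(2) y obtain x x' where x: "(x, y) \<in> set (zip xs ys)" "(x', y') \<in> set (zip xs' ys')"
    by (metis in_set_impl_in_set_zip2)
  then have "x' < x" using assms(3) by (meson set_zip_leftD)
  moreover have "(x, y) \<in> set (zip (xs @ xs') (ys @ ys'))" "(x', y') \<in> set (zip (xs @ xs') (ys @ ys'))"
    using x assms(2) by simp_all
  ultimately show "y' < y"
    using assms(1) unfolding order_isomorphic_zip by (metis fst_conv snd_conv)
qed

lemma order_isomorphic_splitE:
  assumes "order_isomorphic (xs @ xs') ys"
  obtains ys1 ys2 where "ys = ys1 @ ys2" "length xs = length ys1"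
    "order_isomorphic xs ys1" "order_isomorphic xs' ys2"
proof -
  have l: "length xs \<le> length ys"
    using assms by (simp add: order_isomorphic_def)
  let ?a = "take (length xs) ys" and ?b = "drop (length xs) ys"
  have "order_isomorphic (xs @ xs') (?a @ ?b)" "length xs = length ?a"
    using assms l by simp_all
  from order_isomorphic_appendD[OF this] show ?thesis
    using that[of ?a ?b] l by simp
qed

text \<open>Deleting entries of the pattern together with their partners in an occurrence leaves an
  occurrence of the smaller pattern.\<close>

lemma contains_subseq: "subseq \<tau>' \<tau> \<Longrightarrow> contains \<alpha> \<tau> \<Longrightarrow> contains \<alpha> \<tau>'"
proof -
  assume sub: "subseq \<tau>' \<tau>" and "contains \<alpha> \<tau>"
  then obtain \<beta> where \<beta>: "subseq \<beta> \<alpha>" "order_isomorphic \<beta> \<tau>"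
    by (auto simp: contains_def)
  \<comment> \<open>The inclusion of pairs strengthens the induction: when a head is kept, its pair
    has to compare correctly with every pair chosen from the tail.\<close>
  from sub \<beta>(2) have "\<exists>\<beta>'. subseq \<beta>' \<beta> \<and> order_isomorphic \<beta>' \<tau>' \<and> set (zip \<beta>' \<tau>') \<subseteq> set (zip \<beta> \<tau>)"
  proof (induction arbitrary: \<beta> rule: list_emb.induct)
    case (list_emb_Nil ys)
    show ?case by (rule exI[of _ "[]"]) (simp add: order_isomorphic_def)
  next
    case (list_emb_Cons xs ys y)
    then obtain c \<gamma> where [simp]: "\<beta> = c # \<gamma>"
      by (cases \<beta>) (auto simp: order_isomorphic_def)
    have "order_isomorphic \<gamma> ys"
      using list_emb_Cons.prems by (auto simp: order_isomorphic_zip)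
    from list_emb_Cons.IH[OF this] show ?case by auto
  next
    case (list_emb_Cons2 x y xs ys)
    then obtain c \<gamma> where [simp]: "\<beta> = c # \<gamma>"
      by (cases \<beta>) (auto simp: order_isomorphic_def)
    have "order_isomorphic \<gamma> ys"
      using list_emb_Cons2.prems by (auto simp: order_isomorphic_zip)
    from list_emb_Cons2.IH[OF this] obtain \<gamma>' where
      \<gamma>': "subseq \<gamma>' \<gamma>" "order_isomorphic \<gamma>' xs" "set (zip \<gamma>' xs) \<subseteq> set (zip \<gamma> ys)" by blast
    have "order_isomorphic (c # \<gamma>') (x # xs)"
      using \<gamma>' list_emb_Cons2.prems list_emb_Cons2.hyps
      unfolding order_isomorphic_zip by (simp add: subset_iff del: split_paired_All)
    then show ?case using \<gamma>' list_emb_Cons2.hyps by (intro exI[of _ "c # \<gamma>'"]) auto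
  qed
  with \<beta>(1) show "contains \<alpha> \<tau>'"
    unfolding contains_def using subseq_order.trans by blast
qed

lemma subseq_set: "subseq xs ys \<Longrightarrow> set xs \<subseteq> set ys"
  by (auto elim: list_emb_set)

lemma subseq_distinct: "subseq xs ys \<Longrightarrow> distinct ys \<Longrightarrow> distinct xs"
  by (auto simp: subseq_conv_nths)

lemma contains_mono: "subseq \<alpha> \<alpha>' \<Longrightarrow> contains \<alpha> \<tau> \<Longrightarrow> contains \<alpha>' \<tau>"
  unfolding contains_def using subseq_order.trans by blast

lemma contains_Nil [simp]: "contains \<alpha> []"
  by (simp add: contains_def order_isomorphic_def)

lemma contains_length: "contains \<alpha> \<tau> \<Longrightarrow> length \<tau> \<le> length \<alpha>"
  by (auto simp: contains_def order_isomorphic_def dest: list_emb_length)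

text \<open>The entries before the maximum of a 132-avoiding permutation are standardized by a
  shift; this lemma makes the shift harmless.\<close>

lemma contains_map_add: "contains (map (\<lambda>x. x + c) \<alpha>) \<tau> \<longleftrightarrow> contains \<alpha> \<tau>"
proof
  assume "contains \<alpha> \<tau>"
  then obtain \<beta> where "subseq \<beta> \<alpha>" "order_isomorphic \<beta> \<tau>"
    by (auto simp: contains_def)
  then have "subseq (map (\<lambda>x. x + c) \<beta>) (map (\<lambda>x. x + c) \<alpha>)"
    "order_isomorphic (map (\<lambda>x. x + c) \<beta>) \<tau>"
    by (auto simp: order_isomorphic_def intro: subseq_map)
  then show "contains (map (\<lambda>x. x + c) \<alpha>) \<tau>" unfolding contains_def by blast
next
  assume "contains (map (\<lambda>x. x + c) \<alpha>) \<tau>"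
  then obtain \<beta> where \<beta>: "subseq \<beta> (map (\<lambda>x. x + c) \<alpha>)" "order_isomorphic \<beta> \<tau>"
    by (auto simp: contains_def)
  \<comment> \<open>Subtraction on \<open>nat\<close> truncates, but all entries of
    \<open>\<beta>\<close> are at least \<open>c\<close>, so their order survives.\<close>
  have "subseq (map (\<lambda>x. x - c) \<beta>) (map (\<lambda>x. x - c) (map (\<lambda>x. x + c) \<alpha>))"
    using \<beta>(1) by (rule subseq_map)
  moreover have "order_isomorphic (map (\<lambda>x. x - c) \<beta>) \<tau>"
  proof -
    have "\<forall>x\<in>set \<beta>. c \<le> x" using subseq_set[OF \<beta>(1)] by auto
    then have "map (\<lambda>x. x - c) \<beta> ! i < map (\<lambda>x. x - c) \<beta> ! j \<longleftrightarrow> \<beta> ! i < \<beta> ! j"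
      if "i < length \<beta>" "j < length \<beta>" for i j
      using that by (simp add: less_diff_iff)
    with \<beta>(2) show ?thesis by (simp add: order_isomorphic_def)
  qed
  ultimately show "contains \<alpha> \<tau>" unfolding contains_def by (auto simp: o_def)
qed

section \<open>The pattern 132 and the maximum\<close>

lemma contains_132_iff:
  "contains \<alpha> [1, 3, 2] \<longleftrightarrow> (\<exists>x y z. subseq [x, z, y] \<alpha> \<and> x < y \<and> y < z)"
proof
  assume "contains \<alpha> [1, 3, 2]"
  then obtain \<beta> where \<beta>: "subseq \<beta> \<alpha>" "order_isomorphic \<beta> [1, 3, 2]"
    by (auto simp: contains_def)
  then obtain x z y where [simp]: "\<beta> = [x, z, y]"
    by (auto simp: order_isomorphic_def length_Suc_conv)
  have "x < y \<and> y < z" using \<beta>(2) by (simp add: order_isomorphic_def All_less_Suc)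
  with \<beta>(1) show "\<exists>x y z. subseq [x, z, y] \<alpha> \<and> x < y \<and> y < z" by auto
next
  assume "\<exists>x y z. subseq [x, z, y] \<alpha> \<and> x < y \<and> y < z"
  then obtain x y z where "subseq [x, z, y] \<alpha>" "x < y" "y < z" by blast
  moreover from this have "order_isomorphic [x, z, y] [1, 3, 2]"
    by (simp add: order_isomorphic_def All_less_Suc)
  ultimately show "contains \<alpha> [1, 3, 2]" unfolding contains_def by blast
qed

text \<open>An entry \<open>x\<close> of \<open>xs\<close> below an entry \<open>y\<close> of
  \<open>ys\<close> would form the occurrence \<open>x\<close>, \<open>k\<close>, \<open>y\<close>
  of 132; distinctness excludes equality. It serves both for the permutations counted and for the
  pattern.\<close>

lemma avoids_132_split:
  assumes "\<not> contains (xs @ k # ys) [1, 3, 2]" "distinct (xs @ k # ys)"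
    and "\<forall>y\<in>set ys. y < k"
  shows "\<forall>x\<in>set xs. \<forall>y\<in>set ys. y < x"
proof (intro ballI, rule ccontr)
  fix x y assume "x \<in> set xs" "y \<in> set ys" "\<not> y < x"
  with assms have "x < y" "y < k" by (auto simp: order.order_iff_strict)
  moreover have "subseq ([x] @ [k] @ [y]) (xs @ [k] @ ys)"
  proof (rule list_emb_append_mono[OF _ list_emb_append_mono])
    show "subseq [x] xs" "subseq [y] ys" "subseq [k] [k]"
      using \<open>x \<in> set xs\<close> \<open>y \<in> set ys\<close> by (simp_all only: subseq_singleton_left list.set insertI1)
  qed
  ultimately show False using assms(1) unfolding contains_132_iff append_Cons append_Nil by blast
qed

text \<open>An occurrence \<open>x\<close>, \<open>z\<close>, \<open>y\<close> has
  \<open>x < y < z \<le> M\<close>, so \<open>M\<close> can only play \<open>z\<close>. If it starts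
  in \<open>A\<close> and ends after \<open>A\<close>, then \<open>y\<close> lies in
  \<open>B\<close>, hence below \<open>x\<close>, a contradiction. So it lies within
  \<open>A\<close> or within \<open>B\<close>.\<close>

lemma contains_132_insert_max:
  assumes "\<forall>x\<in>set A. \<forall>y\<in>set B. y < x" "\<forall>x\<in>set (A @ B). x < M"
  shows "contains (A @ M # B) [1, 3, 2] \<longleftrightarrow> contains A [1, 3, 2] \<or> contains B [1, 3, 2]"
proof
  assume "contains (A @ M # B) [1, 3, 2]"
  then obtain x y z where s: "subseq [x, z, y] (A @ M # B)" and l: "x < y" "y < z"
    unfolding contains_132_iff by blast
  from s obtain \<beta> \<gamma> where \<beta>: "[x, z, y] = \<beta> @ \<gamma>" "subseq \<beta> A" "subseq \<gamma> (M # B)"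
    by (blast elim: subseq_appendE)
  have in_A: "set \<beta> \<subseteq> set A" and in_B: "set \<gamma> \<subseteq> insert M (set B)"
    using subseq_set[OF \<beta>(2)] subseq_set[OF \<beta>(3)] by simp_all
  consider "\<gamma> = [x, z, y]" | "\<beta> = [x]" "\<gamma> = [z, y]" | "\<beta> = [x, z]" "\<gamma> = [y]" | "\<beta> = [x, z, y]"
    using \<beta>(1) unfolding Cons_eq_append_conv by blast
  then have "subseq [x, z, y] A \<or> subseq [x, z, y] B"
  proof cases
    case 1
    with in_B have "z \<in> insert M (set B)" by simp
    with assms(2) have "z \<le> M" by (auto intro: less_imp_le)
    with l have "x \<noteq> M" by simp
    with \<beta>(3) show ?thesis by (simp add: 1)
  next
    case 2
    then have "x \<in> set A" "y \<in> insert M (set B)" "z \<in> insert M (set B)"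
      using in_A in_B by simp_all
    moreover from this assms(2) have "z \<le> M" by (auto intro: less_imp_le)
    ultimately have "y < x" using assms(1) l by auto
    with l show ?thesis by simp
  next
    case 3
    then have "x \<in> set A" "z \<in> set A" "y \<in> insert M (set B)"
      using in_A in_B by simp_all
    moreover from this assms(2) have "z < M" by simp
    ultimately have "y < x" using assms(1) l by auto
    with l show ?thesis by simp
  next
    case 4
    with \<beta>(2) show ?thesis by simp
  qed
  then show "contains A [1, 3, 2] \<or> contains B [1, 3, 2]"
    using l unfolding contains_132_iff by blast
next
  have "subseq A (A @ M # B)" "subseq B (A @ M # B)"
    by (simp_all add: subseq_rev_drop_many subseq_drop_many list_emb_Cons)
  then show "contains A [1, 3, 2] \<or> contains B [1, 3, 2] \<Longrightarrow> contains (A @ M # B) [1, 3, 2]"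
    by (meson contains_mono)
qed

subsection \<open>The canonical decomposition\<close>

lemma rl_maxima_append:
  "rl_maxima (xs @ ys) = filter (\<lambda>x. \<forall>y\<in>set ys. y < x) (rl_maxima xs) @ rl_maxima ys"
proof (induction xs)
  case Nil
  then show ?case by (simp add: rl_maxima_def)
next
  case (Cons x xs)
  then show ?case by (auto simp: rl_maxima_Cons)
qed

text \<open>Identifies the first right-to-left maximum \<open>m 0\<close> with the largest
  entry.\<close>

lemma le_hd_rl_maxima:
  assumes "xs \<noteq> []"
  shows "rl_maxima xs \<noteq> [] \<and> (\<forall>y\<in>set xs. y \<le> hd (rl_maxima xs))"
  using assms
proof (induction xs)
  case (Cons x xs)
  show ?case
  proof (cases "\<forall>y\<in>set xs. y < x")
    case True
    then show ?thesis by (auto simp: rl_maxima_Cons intro: less_imp_le)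
  next
    case False
    then obtain y where y: "y \<in> set xs" "x \<le> y" by (auto simp: not_less)
    then have IH: "rl_maxima xs \<noteq> []" "\<forall>y\<in>set xs. y \<le> hd (rl_maxima xs)"
      using Cons.IH by fastforce+
    have eq: "rl_maxima (x # xs) = rl_maxima xs"
      using False by (simp add: rl_maxima_Cons)
    have "x \<le> hd (rl_maxima xs)" using y IH(2) by (meson order.trans)
    with IH show ?thesis by (simp add: eq)
  qed
qed simp

lemma segment_self [simp]: "segment b m i i = []"
  by (simp add: segment_def)

lemma segment_Cons: "i < j \<Longrightarrow> segment b m i j = b i @ m i # segment b m (Suc i) j"
  by (simp add: segment_def upt_conv_Cons)

lemma segment_shift: "segment (\<lambda>l. b (Suc l)) (\<lambda>l. m (Suc l)) i j = segment b m (Suc i) (Suc j)"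
  unfolding segment_def map_Suc_upt[symmetric] by (simp add: o_def)

lemma segment_append:
  assumes "i \<le> j" "j \<le> l"
  shows "segment b m i j @ segment b m j l = segment b m i l"
proof -
  have "[i..<l] = [i..<j] @ [j..<l]"
    using upt_add_eq_append[OF assms(1), of "l - j"] assms(2) by simp
  then show ?thesis by (simp add: segment_def)
qed

text \<open>Peels off the first block and its maximum, as the inductions on \<open>r\<close>
  require: the rest is again a 132-avoiding list, whose canonical decomposition is the old one
  shifted by one. For \<open>r = 0\<close> the rest is empty and has no decomposition, hence the
  condition in the last claim.\<close>

lemma canonical_decomposition_unfold:
  assumes "distinct \<tau>" "\<not> contains \<tau> [1, 3, 2]" "canonical_decomposition \<tau> r b m"
  defines "\<rho> \<equiv> segment b m (Suc 0) (Suc r)"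
  shows "\<tau> = b 0 @ m 0 # \<rho>"
    and "\<forall>x\<in>set (b 0 @ \<rho>). x < m 0"
    and "\<forall>x\<in>set (b 0). \<forall>y\<in>set \<rho>. y < x"
    and "distinct \<rho>" and "\<not> contains \<rho> [1, 3, 2]"
    and "\<And>r'. r = Suc r' \<Longrightarrow> canonical_decomposition \<rho> r' (\<lambda>l. b (Suc l)) (\<lambda>l. m (Suc l))"
proof -
  show \<tau>: "\<tau> = b 0 @ m 0 # \<rho>"
    using assms(3) unfolding canonical_decomposition_def \<rho>_def by (simp add: segment_Cons)
  have rl: "map m [0..<Suc r] = rl_maxima \<tau>"
    using assms(3) by (simp add: canonical_decomposition_def)
  have "hd (rl_maxima \<tau>) = m 0"
    by (simp add: upt_conv_Cons flip: rl del: upt_Suc)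
  with le_hd_rl_maxima[of \<tau>] \<tau> have "\<forall>x\<in>set \<tau>. x \<le> m 0" by simp
  with \<tau> assms(1) show less: "\<forall>x\<in>set (b 0 @ \<rho>). x < m 0"
    by (auto simp: order.order_iff_strict)
  show "\<forall>x\<in>set (b 0). \<forall>y\<in>set \<rho>. y < x"
    using avoids_132_split[of "b 0" "m 0" \<rho>] assms(1,2) less \<tau> by simp
  show "distinct \<rho>" using \<tau> assms(1) by simp
  have "subseq \<rho> \<tau>" unfolding \<tau> by (simp add: subseq_drop_many list_emb_Cons)
  with assms(2) show "\<not> contains \<rho> [1, 3, 2]" using contains_mono by blast
  \<comment> \<open>Entries of \<open>b 0\<close> are followed by the larger \<open>m 0\<close>, so
    none of them is a right-to-left maximum of \<open>\<tau>\<close>.\<close>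
  have "filter (\<lambda>x. \<forall>y\<in>set (m 0 # \<rho>). y < x) (rl_maxima (b 0)) = []"
  proof -
    have "x \<in> set (b 0)" if "x \<in> set (rl_maxima (b 0))" for x
      using that by (auto simp: rl_maxima_def)
    with less show ?thesis by (auto simp: filter_empty_conv dest: less_asym)
  qed
  then have "rl_maxima \<tau> = m 0 # rl_maxima \<rho>"
    using less unfolding \<tau> rl_maxima_append by (simp add: rl_maxima_Cons)
  moreover have "map m [0..<Suc r] = m 0 # map (\<lambda>l. m (Suc l)) [0..<r]"
    by (simp add: upt_conv_Cons o_def flip: map_Suc_upt del: upt_Suc)
  ultimately have "map (\<lambda>l. m (Suc l)) [0..<r] = rl_maxima \<rho>" using rl by simp
  then show "canonical_decomposition \<rho> r' (\<lambda>l. b (Suc l)) (\<lambda>l. m (Suc l))" if "r = Suc r'" for r'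
    using that unfolding canonical_decomposition_def segment_shift \<rho>_def by simp
qed

lemma set_segment_mono: "i' \<le> i \<Longrightarrow> j \<le> j' \<Longrightarrow> set (segment b m i j) \<subseteq> set (segment b m i' j')"
  unfolding segment_def by (fastforce simp: set_eq_iff)

text \<open>The first block and \<open>m 0\<close> lie above all later blocks, since
  \<open>\<tau>\<close> avoids 132; the remaining comparisons come from the induction hypothesis for
  the tail.\<close>

lemma segment_decreasing:
  assumes "distinct \<tau>" "\<not> contains \<tau> [1, 3, 2]" "canonical_decomposition \<tau> r b m" "j \<le> r"
  shows "\<forall>x\<in>set (segment b m 0 (Suc j)). \<forall>y\<in>set (segment b m (Suc j) (Suc r)). y < x"
  using assms
proof (induction r arbitrary: \<tau> b m j)
  case 0
  then show ?case by simp
next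
  case (Suc r)
  note unf = canonical_decomposition_unfold[OF Suc.prems(1-3)]
  have seg: "segment b m 0 (Suc j) = b 0 @ m 0 # segment b m (Suc 0) (Suc j)"
    by (simp add: segment_Cons)
  have tail: "set (segment b m (Suc j) (Suc (Suc r))) \<subseteq> set (segment b m (Suc 0) (Suc (Suc r)))"
    by (rule set_segment_mono) simp_all
  have "\<forall>x\<in>set (segment b m (Suc 0) (Suc j)).
      \<forall>y\<in>set (segment b m (Suc j) (Suc (Suc r))). y < x"
  proof (cases j)
    case (Suc j')
    then show ?thesis
      using Suc.IH[OF unf(4,5) unf(6)[OF refl], of j'] Suc.prems(4) by (simp add: segment_shift)
  qed simp
  with unf(2,3) tail show ?case unfolding seg by auto
qed

text \<open>Converse to \<open>segment_decreasing\<close>. The largest entry \<open>m 0\<close>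
  cannot lie in the lower part \<open>\<rho>'\<close>, so \<open>\<rho>\<close> starts with
  \<open>b 0\<close> and \<open>m 0\<close>; the cut is then either right there or a cut of the
  tail.\<close>

lemma decreasing_split_segment:
  assumes "distinct \<tau>" "\<not> contains \<tau> [1, 3, 2]" "canonical_decomposition \<tau> r b m"
    and "\<tau> = \<rho> @ \<rho>'" "\<rho> \<noteq> []" "\<forall>x\<in>set \<rho>. \<forall>y\<in>set \<rho>'. y < x"
  shows "\<exists>j\<le>r. \<rho> = segment b m 0 (Suc j) \<and> \<rho>' = segment b m (Suc j) (Suc r)"
  using assms
proof (induction r arbitrary: \<tau> b m \<rho>)
  case (0 \<tau> b m \<rho>)
  note unf = canonical_decomposition_unfold[OF "0.prems"(1-3)]
  have "\<rho>' = []"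
  proof (rule ccontr)
    assume "\<rho>' \<noteq> []"
    then have "m 0 \<in> set \<rho>'" using unf(1) "0.prems"(4)
      by simp (metis last_append last_in_set last_snoc)
    moreover have "hd \<rho> \<in> set \<rho>" "hd \<rho> \<in> set \<tau>" using "0.prems"(4,5) by auto
    ultimately show False using "0.prems"(6) unf(1,2) by fastforce
  qed
  then show ?case using unf(1) "0.prems"(4) by (auto simp: segment_Cons)
next
  case (Suc r \<tau> b m \<rho>)
  note unf = canonical_decomposition_unfold[OF Suc.prems(1-3)]
  let ?\<sigma> = "segment b m (Suc 0) (Suc (Suc r))"
  have hd: "hd \<rho> \<in> set \<rho>" "hd \<rho> \<in> set \<tau>" using Suc.prems(4,5) by auto
  \<comment> \<open>The head serves as an arbitrary entry of the nonempty \<open>\<rho>\<close>: if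
    \<open>m 0\<close> were in \<open>\<rho>'\<close>, it would have to be below that entry.\<close>
  then have "hd \<rho> \<le> m 0" using unf(1,2) by (auto intro: less_imp_le)
  then have "m 0 \<notin> set \<rho>'" using Suc.prems(6) hd by (meson leD)
  then have "\<exists>us. \<rho> = b 0 @ m 0 # us \<and> ?\<sigma> = us @ \<rho>'"
    using Suc.prems(4) unfolding unf(1)
    by (auto simp: append_eq_append_conv2 Cons_eq_append_conv)
  then obtain us where us: "\<rho> = b 0 @ m 0 # us" "?\<sigma> = us @ \<rho>'" by blast
  show ?case
  proof (cases "us = []")
    case True
    with us show ?thesis by (intro exI[of _ 0]) (simp add: segment_Cons)
  next
    case False
    then obtain j where j: "j \<le> r" "us = segment b m (Suc 0) (Suc (Suc j))"
      "\<rho>' = segment b m (Suc (Suc j)) (Suc (Suc r))"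
      using Suc.IH[OF unf(4,5) unf(6)[OF refl] us(2)] us(1) Suc.prems(6)
      by (auto simp: segment_shift)
    then show ?thesis using us(1) by (intro exI[of _ "Suc j"]) (simp add: segment_Cons)
  qed
qed

section \<open>Occurrences of the pattern across the maximum\<close>

lemma subseq_pi_prefix: "subseq (pi_prefix b m (int j)) (segment b m 0 (Suc j))"
  by (auto simp: pi_prefix_def segment_Cons)

text \<open>An occurrence not using \<open>M\<close> is cut between \<open>A\<close> and
  \<open>B\<close> into a higher and a lower piece, so \<open>decreasing_split_segment\<close>
  locates the cut. One using \<open>M\<close> makes it play \<open>m 0\<close>, which gives
  \<open>j = 0\<close>. Conversely, occurrences in \<open>A\<close> and \<open>B\<close> are joined,
  with \<open>M\<close> inserted exactly for \<open>j = 0\<close>.\<close>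

lemma contains_insert_max_iff_aux:
  assumes \<tau>: "distinct \<tau>" "\<not> contains \<tau> [1, 3, 2]" "canonical_decomposition \<tau> r b m"
    and AB: "\<forall>x\<in>set A. \<forall>y\<in>set B. y < x" "\<forall>x\<in>set (A @ B). x < M"
  shows "contains (A @ M # B) \<tau> \<longleftrightarrow> contains B \<tau> \<or>
    (\<exists>j\<le>r. contains A (pi_prefix b m (int j)) \<and> contains B (sigma_suffix r b m (Suc j)))"
    (is "_ \<longleftrightarrow> ?R")
proof
  note unf = canonical_decomposition_unfold[OF \<tau>]
  assume "contains (A @ M # B) \<tau>"
  then obtain \<beta> where "subseq \<beta> (A @ M # B)" "order_isomorphic \<beta> \<tau>"
    by (auto simp: contains_def)
  then obtain \<beta>1 \<beta>2 where \<beta>: "subseq \<beta>1 A" "subseq \<beta>2 (M # B)"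
    and iso: "order_isomorphic (\<beta>1 @ \<beta>2) \<tau>"
    by (blast elim: subseq_appendE)
  from iso obtain \<rho>1 \<rho>2 where \<rho>: "\<tau> = \<rho>1 @ \<rho>2" "length \<beta>1 = length \<rho>1"
    "order_isomorphic \<beta>1 \<rho>1" "order_isomorphic \<beta>2 \<rho>2"
    by (rule order_isomorphic_splitE)
  have cA: "contains A \<rho>1" using \<beta>(1) \<rho>(3) by (auto simp: contains_def)
  show ?R
  proof (cases "subseq \<beta>2 B")
    case True
    then have cB: "contains B \<rho>2" using \<rho>(4) by (auto simp: contains_def)
    show ?thesis
    proof (cases "\<rho>1 = []")
      case True
      with cB \<rho>(1) show ?thesis by simp
    next
      case False
      have "\<forall>x\<in>set \<beta>1. \<forall>y\<in>set \<beta>2. y < x"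
        using subseq_set[OF \<beta>(1)] subseq_set[OF True] AB(1) by blast
      then have "\<forall>x\<in>set \<rho>1. \<forall>y\<in>set \<rho>2. y < x"
        using order_isomorphic_less iso \<rho>(1,2) by blast
      then obtain j where j: "j \<le> r" "\<rho>1 = segment b m 0 (Suc j)" "\<rho>2 = segment b m (Suc j) (Suc r)"
        using decreasing_split_segment[OF \<tau> \<rho>(1) False] by blast
      \<comment> \<open>For \<open>j = 0\<close> the prefix \<open>pi_prefix b m 0\<close> lacks the
        last entry \<open>m 0\<close> of \<open>\<rho>1\<close>, so containment in \<open>A\<close>
        is only weakened.\<close>
      then show ?thesis
        using contains_subseq[OF subseq_pi_prefix] cA cB unfolding sigma_suffix_def by blast
    qed
  next
    case False
    then obtain \<gamma> where \<gamma>: "\<beta>2 = M # \<gamma>" "subseq \<gamma> B"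
      using \<beta>(2) by (cases \<beta>2) (auto split: if_splits)
    then obtain k \<rho>3 where [simp]: "\<rho>2 = k # \<rho>3"
      using order_isomorphic_length[OF \<rho>(4)] by (cases \<rho>2) auto
    have "order_isomorphic ([M] @ \<gamma>) ([k] @ \<rho>3)" using \<rho>(4) \<gamma>(1) by simp
    then have "order_isomorphic \<gamma> \<rho>3" by (rule order_isomorphic_appendD) simp
    with \<gamma>(2) have cB: "contains B \<rho>3" by (auto simp: contains_def)
    \<comment> \<open>\<open>M\<close> is the largest entry of the occurrence, so its partner
      \<open>k\<close> is the largest entry of \<open>\<tau>\<close>, namely
      \<open>m 0\<close>.\<close>
    have "snd p \<le> k" if "p \<in> set (zip (\<beta>1 @ \<beta>2) \<tau>)" for p
    proof -
      have "fst p \<in> set (\<beta>1 @ \<beta>2)" using in_set_zipD[OF that] by simp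
      then have "\<not> M < fst p"
        using subseq_set[OF \<beta>(1)] subseq_set[OF \<beta>(2)] AB(2) by (auto dest: less_asym)
      moreover have "(M, k) \<in> set (zip (\<beta>1 @ \<beta>2) \<tau>)"
        using \<rho>(1,2) \<gamma>(1) by simp
      ultimately have "\<not> k < snd p"
        using iso that unfolding order_isomorphic_zip by (metis fst_conv snd_conv)
      then show ?thesis by simp
    qed
    then have "y \<le> k" if "y \<in> set \<tau>" for y
      using that order_isomorphic_length[OF iso] by (metis in_set_impl_in_set_zip2 snd_conv)
    moreover have "m 0 \<in> set \<tau>" "k \<in> set \<tau>" by (subst unf(1), simp) (simp add: \<rho>(1))
    moreover from \<open>k \<in> set \<tau>\<close> have "k \<le> m 0"
      using unf(2) by (subst (asm) unf(1)) (auto intro: less_imp_le)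
    ultimately have "k = m 0" by (simp add: le_antisym)
    then have "\<rho>1 @ m 0 # \<rho>3 = b 0 @ m 0 # segment b m (Suc 0) (Suc r)"
      using \<rho>(1) unf(1) by simp
    \<comment> \<open>As \<open>m 0\<close> occurs only once, both factorizations of
      \<open>\<tau>\<close> around it coincide.\<close>
    moreover have "m 0 \<notin> set \<rho>1" "m 0 \<notin> set \<rho>3" using \<tau>(1) \<rho>(1) \<open>k = m 0\<close> by auto
    ultimately have "\<rho>1 = b 0" "\<rho>3 = segment b m (Suc 0) (Suc r)"
      by (simp_all add: append_Cons_eq_iff)
    with cA cB show ?thesis
      by (intro disjI2 exI[of _ 0]) (simp add: pi_prefix_def sigma_suffix_def)
  qed
next
  note unf = canonical_decomposition_unfold[OF \<tau>]
  assume ?R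
  then show "contains (A @ M # B) \<tau>"
  proof
    assume "contains B \<tau>"
    moreover have "subseq B (A @ M # B)" by (simp add: subseq_drop_many list_emb_Cons)
    ultimately show ?thesis using contains_mono by blast
  next
    assume "\<exists>j\<le>r. contains A (pi_prefix b m (int j)) \<and> contains B (sigma_suffix r b m (Suc j))"
    then obtain j \<beta> \<gamma> where j: "j \<le> r"
      and \<beta>: "subseq \<beta> A" "order_isomorphic \<beta> (pi_prefix b m (int j))"
      and \<gamma>: "subseq \<gamma> B" "order_isomorphic \<gamma> (segment b m (Suc j) (Suc r))"
      by (auto simp: contains_def sigma_suffix_def)
    have less: "\<forall>x\<in>set \<beta>. \<forall>y\<in>set \<gamma>. y < x"
      using subseq_set[OF \<beta>(1)] subseq_set[OF \<gamma>(1)] AB(1) by blast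
    have iso: "order_isomorphic (\<beta> @ \<gamma>) (pi_prefix b m (int j) @ segment b m (Suc j) (Suc r))"
      using segment_decreasing[OF \<tau> j] subseq_set[OF subseq_pi_prefix, of b m j]
      by (intro order_isomorphic_append \<beta>(2) \<gamma>(2) less) blast
    show ?thesis
    proof (cases "j = 0")
      case True
      \<comment> \<open>The joined pattern lacks \<open>m 0\<close> here, and \<open>M\<close>
        supplies it. For \<open>j > 0\<close> the joined pattern is already all of
        \<open>\<tau>\<close>.\<close>
      with iso have iso0: "order_isomorphic (\<beta> @ \<gamma>) (b 0 @ segment b m (Suc 0) (Suc r))"
        by (simp add: pi_prefix_def)
      have "length \<beta> = length (b 0)"
        using \<beta>(2) True by (simp add: pi_prefix_def order_isomorphic_length)
      moreover have "\<forall>x\<in>set (\<beta> @ \<gamma>). x < M"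
        using subseq_set[OF \<beta>(1)] subseq_set[OF \<gamma>(1)] AB(2) by auto
      ultimately have "order_isomorphic (\<beta> @ M # \<gamma>) \<tau>"
        using order_isomorphic_insert_max[OF iso0 _ _ unf(2)] unf(1) by simp
      moreover have "subseq (\<beta> @ M # \<gamma>) (A @ M # B)"
        using \<beta>(1) \<gamma>(1) by (intro list_emb_append_mono subseq_Cons2)
      ultimately show ?thesis by (auto simp: contains_def)
    next
      case False
      then have "pi_prefix b m (int j) @ segment b m (Suc j) (Suc r) = \<tau>"
        using j \<tau>(3) by (simp add: pi_prefix_def segment_append canonical_decomposition_def)
      moreover have "subseq (\<beta> @ \<gamma>) (A @ M # B)"
        using \<beta>(1) \<gamma>(1) by (intro list_emb_append_mono list_emb_Cons)
      ultimately show ?thesis using iso by (auto simp: contains_def)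
    qed
  qed
qed


lemma ex_le_Suc_iff: "(\<exists>i\<le>Suc r. P i) \<longleftrightarrow> P 0 \<or> (\<exists>j\<le>r. P (Suc j))"
  by (metis Suc_le_mono le0 not0_implies_Suc)

text \<open>The case of \<open>\<tau>\<close> lying entirely in \<open>B\<close> becomes
  \<open>i = 0\<close>, because \<pi>^{-1} is empty; the old index \<open>j\<close> becomes
  \<open>i = Suc j\<close>.\<close>

lemma contains_insert_max_iff:
  assumes "distinct \<tau>" "\<not> contains \<tau> [1, 3, 2]" "canonical_decomposition \<tau> r b m"
    and "\<forall>x\<in>set A. \<forall>y\<in>set B. y < x" "\<forall>x\<in>set (A @ B). x < M"
  shows "contains (A @ M # B) \<tau> \<longleftrightarrow>
    (\<exists>i\<le>Suc r. contains A (pi_prefix b m (int i - 1)) \<and> contains B (sigma_suffix r b m i))"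
proof -
  have "sigma_suffix r b m 0 = \<tau>" "pi_prefix b m (int 0 - 1) = []"
    using assms(3) by (simp_all add: sigma_suffix_def canonical_decomposition_def pi_prefix_def)
  then show ?thesis
    unfolding contains_insert_max_iff_aux[OF assms] ex_le_Suc_iff by simp
qed

section \<open>Growing prefixes, shrinking suffixes and the crossing index\<close>

lemma subseq_pi_prefix_Suc: "subseq (pi_prefix b m (int i - 1)) (pi_prefix b m (int (Suc i) - 1))"
proof (cases i)
  case 0
  then show ?thesis by (simp add: pi_prefix_def)
next
  case (Suc k)
  show ?thesis
  proof (cases k)
    case 0
    \<comment> \<open>From \<pi>^0 to \<pi>^1 the prefix gains the missing \<open>m 0\<close> as
      well as the next block and its maximum.\<close>
    with Suc show ?thesis by (simp add: pi_prefix_def segment_Cons subseq_rev_drop_many)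
  next
    case (Suc k')
    then have "pi_prefix b m (int (Suc i) - 1) =
        pi_prefix b m (int i - 1) @ segment b m (Suc k) (Suc (Suc k))"
      using \<open>i = Suc k\<close> by (simp add: pi_prefix_def segment_append nat_add_distrib)
    then show ?thesis by (simp only: subseq_rev_drop_many subseq_order.order_refl)
  qed
qed

lemma subseq_sigma_suffix_Suc:
  "i \<le> r \<Longrightarrow> subseq (sigma_suffix r b m (Suc i)) (sigma_suffix r b m i)"
  by (simp add: sigma_suffix_def segment_Cons subseq_drop_many list_emb_Cons)

text \<open>
  Below, $p\,i$ states that $A$ contains $\pi^{i-1}$ and $q\,i$ that $B$ contains $\sigma^i$.
\<close>

lemma crossing_iff:
  fixes p q :: "nat \<Rightarrow> bool"
  assumes "\<And>i. p (Suc i) \<Longrightarrow> p i" "\<And>i. i \<le> r \<Longrightarrow> q i \<Longrightarrow> q (Suc i)" "p 0" "q (Suc r)"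
  shows "\<not> (\<exists>i\<le>Suc r. p i \<and> q i) \<longleftrightarrow> (\<exists>j\<le>r. p j \<and> \<not> p (Suc j) \<and> \<not> q j)"
proof
  assume L: "\<not> (\<exists>i\<le>Suc r. p i \<and> q i)"
  \<comment> \<open>\<open>p\<close> holds at 0 and fails at \<open>Suc r\<close>, so it drops after
    some \<open>j\<close>; there \<open>q\<close> fails because \<open>p\<close> still
    holds.\<close>
  with assms(4) have "\<not> p (Suc r)" by blast
  then obtain j where j: "j < Suc r" "p j" "\<not> p (Suc j)"
    using assms(3) dec_induct[of 0 "Suc r" p] by (metis le0 le_trans less_le_not_le)
  with L show "\<exists>j\<le>r. p j \<and> \<not> p (Suc j) \<and> \<not> q j" by (metis le_SucI less_Suc_eq_le)
next
  assume "\<exists>j\<le>r. p j \<and> \<not> p (Suc j) \<and> \<not> q j"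
  then obtain j where j: "j \<le> r" "p j" "\<not> p (Suc j)" "\<not> q j" by blast
  have p: "p i" if "p k" "i \<le> k" for i k
    using that(2,1) by (induction rule: inc_induct) (auto intro: assms(1))
  have q: "q k" if "q i" "i \<le> k" "k \<le> j" for i k
    using that(2,1,3) by (induction rule: dec_induct) (use j(1) assms(2) in auto)
  show "\<not> (\<exists>i\<le>Suc r. p i \<and> q i)"
  proof clarify
    fix i assume "p i" "q i"
    \<comment> \<open>If \<open>i \<le> j\<close>, then \<open>q\<close> propagates upwards to
      \<open>j\<close>; otherwise \<open>p\<close> propagates downwards to
      \<open>Suc j\<close>.\<close>
    then show False using p[of i "Suc j"] q[of i j] j by (cases "i \<le> j") auto
  qed
qed

text \<open>A decreasing predicate drops only once. This makes the classes counted below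
  disjoint.\<close>

lemma crossing_unique:
  fixes p :: "nat \<Rightarrow> bool"
  assumes "\<And>i. p (Suc i) \<Longrightarrow> p i" "p j" "\<not> p (Suc j)" "p k" "\<not> p (Suc k)"
  shows "j = k"
proof -
  have p: "p i" if "p k" "i \<le> k" for i k
    using that(2,1) by (induction rule: inc_induct) (auto intro: assms(1))
  show ?thesis using p[of j "Suc k"] p[of k "Suc j"] assms(2-5) by (metis not_less_eq_eq le_antisym)
qed

subsection \<open>Decomposing permutations at their maximum\<close>

text \<open>Inverse to cutting a 132-avoiding permutation at its maximum; both arguments are
  standardized, so \<open>A\<close> is lifted above \<open>B\<close>.\<close>

definition glue :: "nat list \<Rightarrow> nat list \<Rightarrow> nat list" where
  "glue A B = map (\<lambda>x. x + length B) A @ Suc (length A + length B) # B"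

lemma permutations_of_set_length: "xs \<in> permutations_of_set {1..n} \<Longrightarrow> length xs = n"
  by (drule length_finite_permutations_of_set) simp

lemma glue_less:
  assumes "A \<in> permutations_of_set {1..l}" "B \<in> permutations_of_set {1..n}"
  shows "\<forall>x\<in>set (map (\<lambda>x. x + length B) A). \<forall>y\<in>set B. y < x"
    and "\<forall>x\<in>set (map (\<lambda>x. x + length B) A @ B). x < Suc (length A + length B)"
proof -
  have "set A = {1..length A}" "set B = {1..length B}"
    using assms by (simp_all add: permutations_of_setD(1) permutations_of_set_length)
  then have A: "0 < x \<and> x \<le> length A" if "x \<in> set A" for x
    using that by auto
  have B: "y \<le> length B" if "y \<in> set B" for y
    using that \<open>set B = _\<close> by auto
  have "y < x + length B" if "x \<in> set A" "y \<in> set B" for x y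
    using A[OF that(1)] B[OF that(2)] by linarith
  then show "\<forall>x\<in>set (map (\<lambda>x. x + length B) A). \<forall>y\<in>set B. y < x"
    by simp
  show "\<forall>x\<in>set (map (\<lambda>x. x + length B) A @ B). x < Suc (length A + length B)"
    using A B by (simp add: ball_Un less_Suc_eq_le trans_le_add2)
qed

lemma glue_permutation:
  assumes "A \<in> permutations_of_set {1..l}" "B \<in> permutations_of_set {1..n}"
  shows "glue A B \<in> permutations_of_set {1..Suc (l + n)}"
proof
  note A = permutations_of_setD[OF assms(1)] and B = permutations_of_setD[OF assms(2)]
  note len = permutations_of_set_length[OF assms(1)] permutations_of_set_length[OF assms(2)]
  have "(\<lambda>x. x + n) ` {1..l} = {Suc n..l + n}"
    by (simp add: image_add_atLeastAtMost' add.commute)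
  then show "set (glue A B) = {1..Suc (l + n)}" by (auto simp: glue_def A B len)
  show "distinct (glue A B)"
    using glue_less[OF assms] A(2) B(2) unfolding glue_def by (fastforce simp: distinct_map)
qed

lemma down_closed_eq_atLeastAtMost:
  assumes "finite D" "\<And>x. x \<in> D \<Longrightarrow> 1 \<le> x" "\<And>x y. x \<in> D \<Longrightarrow> 1 \<le> y \<Longrightarrow> y < x \<Longrightarrow> y \<in> D"
  shows "D = {1..card D :: nat}"
proof (cases "D = {}")
  case False
  have "D = {1..Max D}"
  proof (intro equalityI subsetI)
    fix x assume "x \<in> {1..Max D}"
    then show "x \<in> D" using assms(3)[OF Max_in[OF assms(1) False], of x] Max_in[OF assms(1) False]
      by (cases "x = Max D") auto
  next
    fix x assume "x \<in> D"
    then show "x \<in> {1..Max D}" using assms(1,2) by simp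
  qed
  moreover from this have "card D = Max D" by (metis card_atLeastAtMost diff_Suc_1)
  ultimately show ?thesis by simp
qed simp

text \<open>Avoiding 132 puts the entries before the maximum above those after it. Hence the values
  in \<open>B\<close> are closed downwards and form \<open>{1..length B}\<close>, and subtracting
  \<open>length B\<close> standardizes \<open>A\<close>.\<close>

lemma glue_cases:
  assumes "\<alpha> \<in> permutations_of_set {1..Suc n}" "\<not> contains \<alpha> [1, 3, 2]"
  obtains l A B where "l \<le> n" "A \<in> permutations_of_set {1..l}"
    "B \<in> permutations_of_set {1..n - l}" "\<alpha> = glue A B"
proof -
  note \<alpha> = permutations_of_setD[OF assms(1)]
  have "Suc n \<in> set \<alpha>" using \<alpha>(1) by simp
  then obtain A B where AB: "\<alpha> = A @ Suc n # B" by (metis in_set_conv_decomp)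
  have dist: "distinct A" "distinct B" "set A \<inter> set B = {}" "Suc n \<notin> set A" "Suc n \<notin> set B"
    using \<alpha>(2) AB by auto
  have un: "set A \<union> set B = {1..n}"
  proof -
    have "insert (Suc n) (set A \<union> set B) = {1..Suc n}" using \<alpha>(1) AB by simp
    also have "\<dots> = insert (Suc n) {1..n}" by (simp add: atLeastAtMostSuc_conv)
    finally show ?thesis
      using insert_ident[of "Suc n" "set A \<union> set B" "{1..n}"] dist(4,5) by simp
  qed
  have "\<forall>y\<in>set B. y < Suc n" using un by (auto simp: less_Suc_eq_le)
  then have less: "\<forall>x\<in>set A. \<forall>y\<in>set B. y < x"
    using avoids_132_split[of A "Suc n" B] assms(2) \<alpha>(2) AB by simp
  have "set B = {1..card (set B)}"
  proof (rule down_closed_eq_atLeastAtMost)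
    fix x y assume "x \<in> set B" "1 \<le> y" "y < x"
    moreover from this un have "y \<in> set A \<union> set B" by (metis Un_iff atLeastAtMost_iff le_trans less_imp_le)
    ultimately show "y \<in> set B" using less by fastforce
  qed (use un in auto)
  then have B: "set B = {1..length B}" using dist(2) by (simp add: distinct_card)
  have len: "length A + length B = n"
    using arg_cong[OF un, of card] dist by (simp add: card_Un_disjoint distinct_card)
  have "set A = {1..n} - set B" using un dist(3) by auto
  then have A: "set A = {Suc (length B)..n}" using B by auto
  define A' where "A' = map (\<lambda>x. x - length B) A"
  have shift: "map (\<lambda>x. x + length B) A' = A"
    unfolding A'_def map_map using A by (intro map_idI) auto
  have "set A' = {1..length A}"
  proof -
    have "(\<lambda>x. x + length B) ` set A' = (\<lambda>x. x + length B) ` {1..length A}"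
      using shift A len by (simp add: image_add_atLeastAtMost' add.commute flip: set_map)
    moreover have "inj (\<lambda>x. x + length B)" by simp
    ultimately show ?thesis by (simp only: inj_image_eq_iff)
  qed
  moreover have "distinct A'" using dist(1) shift by (metis distinct_map)
  ultimately have "A' \<in> permutations_of_set {1..length A}" by (rule permutations_of_setI)
  moreover have "B \<in> permutations_of_set {1..n - length A}"
    using B dist(2) len by (intro permutations_of_setI) auto
  moreover have "\<alpha> = glue A' B"
    unfolding glue_def shift using AB len by (simp add: A'_def)
  ultimately show ?thesis using that[of "length A" A' B] len by simp
qed

text \<open>The maximum \<open>Suc n\<close> occurs once, so it determines the cut; the right parts
  then agree, and with them the shifts of the left parts.\<close>

lemma glue_inj:
  assumes "A \<in> permutations_of_set {1..l}" "B \<in> permutations_of_set {1..n - l}" "l \<le> n"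
    and "A' \<in> permutations_of_set {1..l'}" "B' \<in> permutations_of_set {1..n - l'}" "l' \<le> n"
    and eq: "glue A B = glue A' B'"
  shows "A = A'" "B = B'"
proof -
  note len = assms(1,2,4,5)[THEN permutations_of_set_length]
  let ?A = "map (\<lambda>x. x + length B) A" and ?A' = "map (\<lambda>x. x + length B') A'"
  have eq': "?A @ Suc n # B = ?A' @ Suc n # B'"
    using eq assms(3,6) by (simp add: glue_def len)
  have "Suc n \<notin> set ?A" "Suc n \<notin> set B"
    using glue_less(2)[OF assms(1,2)] assms(3) len by auto
  then have *: "?A = ?A'" "B = B'" using eq' append_Cons_eq_iff[of "Suc n" ?A B ?A' B'] by blast+
  have "inj (\<lambda>x. x + length B)" by simp
  moreover have "?A = map (\<lambda>x. x + length B) A'" using * by simp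
  ultimately show "A = A'" by (simp only: inj_map_eq_map)
  show "B = B'" by (rule *(2))
qed


section \<open>Enumeration of the avoiders and the recurrence\<close>

lemma finite_avoiders: "finite (avoiders n T)"
  by (simp add: avoiders_def)

lemma avoiders_mono:
  assumes "subseq \<tau>' \<tau>"
  shows "avoiders n {\<rho>, \<tau>'} \<subseteq> avoiders n {\<rho>, \<tau>}"
  using contains_subseq[OF assms] by (auto simp: avoiders_def)

text \<open>Combines the containment criterion with \<open>crossing_iff\<close>. Membership in the
  set difference says that \<open>A\<close> avoids \<pi>^j but contains \<pi>^{j-1}.\<close>

lemma glue_avoids_iff:
  assumes \<tau>: "distinct \<tau>" "\<not> contains \<tau> [1, 3, 2]" "canonical_decomposition \<tau> r b m"
    and AB: "A \<in> permutations_of_set {1..l}" "B \<in> permutations_of_set {1..n}"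
  shows "glue A B \<in> avoiders (Suc (l + n)) {[1, 3, 2], \<tau>} \<longleftrightarrow>
    (\<exists>j\<le>r. A \<in> avoiders l {[1, 3, 2], pi_prefix b m (int j)} -
        avoiders l {[1, 3, 2], pi_prefix b m (int j - 1)} \<and>
      B \<in> avoiders n {[1, 3, 2], sigma_suffix r b m j})"
proof -
  let ?p = "\<lambda>i. contains A (pi_prefix b m (int i - 1))"
  let ?q = "\<lambda>i. contains B (sigma_suffix r b m i)"
  have "\<not> (\<exists>i\<le>Suc r. ?p i \<and> ?q i) \<longleftrightarrow> (\<exists>j\<le>r. ?p j \<and> \<not> ?p (Suc j) \<and> \<not> ?q j)"
  proof (rule crossing_iff)
    show "?p i" if "?p (Suc i)" for i
      using contains_subseq[OF subseq_pi_prefix_Suc that] .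
    show "?q (Suc i)" if "i \<le> r" "?q i" for i
      using contains_subseq[OF subseq_sigma_suffix_Suc[OF that(1)] that(2)] .
  \<comment> \<open>Boundary values: \<pi>^{-1} and \<sigma>^{r+1} are empty and thus contained in
    everything.\<close>
  qed (simp_all add: pi_prefix_def sigma_suffix_def)
  moreover have "contains (glue A B) \<tau> \<longleftrightarrow> (\<exists>i\<le>Suc r. ?p i \<and> ?q i)"
    unfolding glue_def contains_insert_max_iff[OF \<tau> glue_less[OF AB]] contains_map_add ..
  moreover have "contains (glue A B) [1, 3, 2] \<longleftrightarrow> contains A [1, 3, 2] \<or> contains B [1, 3, 2]"
    unfolding glue_def contains_132_insert_max[OF glue_less[OF AB]] contains_map_add ..
  ultimately show ?thesis
    using AB glue_permutation[OF AB] by (auto simp: avoiders_def)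
qed

lemma avoid_count_0:
  assumes "\<tau> \<noteq> []"
  shows "avoid_count \<tau> 0 = 1"
proof -
  have "avoiders 0 {[1, 3, 2], \<tau>} = {[]}"
    using assms by (auto simp: avoiders_def dest: contains_length)
  then show ?thesis by (simp add: avoid_count_def)
qed

lemma avoid_count_Suc:
  assumes \<tau>: "distinct \<tau>" "\<not> contains \<tau> [1, 3, 2]" "canonical_decomposition \<tau> r b m"
  shows "rat_of_nat (avoid_count \<tau> (Suc n)) = (\<Sum>j=0..r. \<Sum>l=0..n.
    (rat_of_nat (avoid_count (pi_prefix b m (int j)) l) -
     rat_of_nat (avoid_count (pi_prefix b m (int j - 1)) l)) *
    rat_of_nat (avoid_count (sigma_suffix r b m j) (n - l)))"
proof -
  let ?A = "\<lambda>j l. avoiders l {[1, 3, 2], pi_prefix b m (int j)}"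
  let ?A' = "\<lambda>j l. avoiders l {[1, 3, 2], pi_prefix b m (int j - 1)}"
  let ?B = "\<lambda>j l. avoiders (n - l) {[1, 3, 2], sigma_suffix r b m j}"
  \<comment> \<open>Classes of pairs \<open>(A, B)\<close>: \<open>j\<close> is the crossing index
    of \<open>A\<close> and \<open>l\<close> is the length of \<open>A\<close>.\<close>
  define C where "C = (\<lambda>(j, l). (?A j l - ?A' j l) \<times> ?B j l)"
  define I where "I = {0..r} \<times> {0..n}"
  have C_perm: "l \<le> n" "A \<in> permutations_of_set {1..l}" "B \<in> permutations_of_set {1..n - l}"
    if "(j, l) \<in> I" "(A, B) \<in> C (j, l)" for j l A B
    using that by (auto simp: C_def I_def avoiders_def)
  have "avoiders (Suc n) {[1, 3, 2], \<tau>} = (\<lambda>(A, B). glue A B) ` (\<Union>p\<in>I. C p)"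
  proof (intro equalityI subsetI)
    fix \<alpha> assume \<alpha>: "\<alpha> \<in> avoiders (Suc n) {[1, 3, 2], \<tau>}"
    then have "\<alpha> \<in> permutations_of_set {1..Suc n}" "\<not> contains \<alpha> [1, 3, 2]"
      by (simp_all add: avoiders_def)
    then obtain l A B where AB: "l \<le> n" "A \<in> permutations_of_set {1..l}"
      "B \<in> permutations_of_set {1..n - l}" "\<alpha> = glue A B"
      by (rule glue_cases)
    with \<alpha> glue_avoids_iff[OF \<tau> AB(2,3)] obtain j where
      "j \<le> r" "A \<in> ?A j l - ?A' j l" "B \<in> ?B j l" by auto
    then have "(A, B) \<in> C (j, l)" "(j, l) \<in> I" using AB(1) by (auto simp: C_def I_def)
    then show "\<alpha> \<in> (\<lambda>(A, B). glue A B) ` (\<Union>p\<in>I. C p)"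
      using AB(4) by (intro image_eqI[of _ _ "(A, B)"]) auto
  next
    fix \<alpha> assume "\<alpha> \<in> (\<lambda>(A, B). glue A B) ` (\<Union>p\<in>I. C p)"
    then obtain j l A B where AB: "(j, l) \<in> I" "(A, B) \<in> C (j, l)" "\<alpha> = glue A B" by auto
    then have "\<exists>j\<le>r. A \<in> ?A j l - ?A' j l \<and> B \<in> ?B j l" by (auto simp: C_def I_def)
    then show "\<alpha> \<in> avoiders (Suc n) {[1, 3, 2], \<tau>}"
      using glue_avoids_iff[OF \<tau> C_perm(2,3)[OF AB(1,2)]] C_perm(1)[OF AB(1,2)] AB(3) by simp
  qed
  moreover have "inj_on (\<lambda>(A, B). glue A B) (\<Union>p\<in>I. C p)"
  proof (rule inj_onI)
    fix u v assume "u \<in> (\<Union>p\<in>I. C p)" "v \<in> (\<Union>p\<in>I. C p)"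
      and eq: "(\<lambda>(A, B). glue A B) u = (\<lambda>(A, B). glue A B) v"
    moreover obtain A B A' B' where "u = (A, B)" "v = (A', B')" by (metis surj_pair)
    ultimately obtain p p' where p: "u = (A, B)" "v = (A', B')"
      "p \<in> I" "(A, B) \<in> C p" "p' \<in> I" "(A', B') \<in> C p'" by blast
    moreover obtain j l j' l' where "p = (j, l)" "p' = (j', l')" by (metis surj_pair)
    ultimately have uv: "u = (A, B)" "v = (A', B')" "(j, l) \<in> I" "(A, B) \<in> C (j, l)"
      "(j', l') \<in> I" "(A', B') \<in> C (j', l')" by simp_all
    with eq show "u = v"
      using glue_inj[OF C_perm(2,3,1)[OF uv(3,4)] C_perm(2,3,1)[OF uv(5,6)]] by simp
  qed
  ultimately have "avoid_count \<tau> (Suc n) = card (\<Union>p\<in>I. C p)"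
    by (simp add: avoid_count_def card_image)
  also have "\<dots> = (\<Sum>p\<in>I. card (C p))"
  proof (rule card_UN_disjoint)
    show "\<forall>p\<in>I. \<forall>p'\<in>I. p \<noteq> p' \<longrightarrow> C p \<inter> C p' = {}"
    proof (intro ballI impI, rule ccontr)
      fix p p' assume p: "p \<in> I" "p' \<in> I" "p \<noteq> p'" "C p \<inter> C p' \<noteq> {}"
      then obtain A B j l j' l' where p_eq: "p = (j, l)" "p' = (j', l')"
        and AB: "(A, B) \<in> C (j, l)" "(A, B) \<in> C (j', l')" by (metis IntE equals0I surj_pair)
      have "l = l'"
        using C_perm(2)[of j l A B] C_perm(2)[of j' l' A B] p AB p_eq
          permutations_of_set_length by metis
      let ?p = "\<lambda>i. contains A (pi_prefix b m (int i - 1))"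
      \<comment> \<open>Both indices are places where containment of the prefixes in the same list
        \<open>A\<close> drops.\<close>
      have "j = j'"
      proof (rule crossing_unique)
        show "?p i" if "?p (Suc i)" for i
          using contains_subseq[OF subseq_pi_prefix_Suc that] .
        show "?p j" "\<not> ?p (Suc j)" "?p j'" "\<not> ?p (Suc j')"
          using AB by (auto simp: C_def avoiders_def)
      qed
      with \<open>l = l'\<close> p(3) p_eq show False by simp
    qed
  qed (auto simp: I_def C_def finite_avoiders)
  finally have "rat_of_nat (avoid_count \<tau> (Suc n)) = (\<Sum>p\<in>I. rat_of_nat (card (C p)))"
    by simp
  also have "rat_of_nat (card (C (j, l))) =
    (rat_of_nat (avoid_count (pi_prefix b m (int j)) l) -
     rat_of_nat (avoid_count (pi_prefix b m (int j - 1)) l)) *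
    rat_of_nat (avoid_count (sigma_suffix r b m j) (n - l))" for j l
  proof -
    \<comment> \<open>Avoiding the shorter prefix implies avoiding the longer one, so the size of
      the set difference is a true difference of counts, without truncation on
      \<open>nat\<close>.\<close>
    have sub: "?A' j l \<subseteq> ?A j l"
      using avoiders_mono[OF subseq_pi_prefix_Suc[of b m j]] by simp
    then have "card (?A j l - ?A' j l) = card (?A j l) - card (?A' j l)" "card (?A' j l) \<le> card (?A j l)"
      by (simp_all add: card_Diff_subset card_mono finite_avoiders)
    then show ?thesis by (simp add: C_def card_cartesian_product avoid_count_def of_nat_diff)
  qed
  then have "(\<Sum>p\<in>I. rat_of_nat (card (C p))) = (\<Sum>(j, l)\<in>I.
    (rat_of_nat (avoid_count (pi_prefix b m (int j)) l) -
     rat_of_nat (avoid_count (pi_prefix b m (int j - 1)) l)) *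
    rat_of_nat (avoid_count (sigma_suffix r b m j) (n - l)))"
    by (intro sum.cong) auto
  finally show ?thesis unfolding I_def by (simp add: sum.cartesian_product)
qed

lemma canonical_decomposition_nonempty: "canonical_decomposition \<tau> r b m \<Longrightarrow> \<tau> \<noteq> []"
  by (auto simp: canonical_decomposition_def segment_Cons)

lemma avoid_gf_recurrence:
  assumes \<tau>: "distinct \<tau>" "\<not> contains \<tau> [1, 3, 2]" "canonical_decomposition \<tau> r b m"
  shows "avoid_gf \<tau> = 1 + fps_X * (\<Sum>j=0..r.
    (avoid_gf (pi_prefix b m (int j)) - avoid_gf (pi_prefix b m (int j - 1))) *
    avoid_gf (sigma_suffix r b m j))"
proof (rule fps_ext)
  fix n
  show "fps_nth (avoid_gf \<tau>) n = fps_nth (1 + fps_X * (\<Sum>j=0..r.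
    (avoid_gf (pi_prefix b m (int j)) - avoid_gf (pi_prefix b m (int j - 1))) *
    avoid_gf (sigma_suffix r b m j))) n"
  proof (cases n)
    case 0
    then show ?thesis
      using avoid_count_0[OF canonical_decomposition_nonempty[OF \<tau>(3)]] by (simp add: avoid_gf_def)
  next
    case (Suc k)
    have gf: "fps_nth (avoid_gf \<tau>) n = rat_of_nat (avoid_count \<tau> (Suc k))" by (simp add: avoid_gf_def Suc)
    \<comment> \<open>At the positive index \<open>n = Suc k\<close> the summand 1 vanishes and
      \<open>fps_X\<close> shifts the index; the sum over \<open>l\<close> is then a Cauchy
      product.\<close>
    have step: "fps_nth (1 + fps_X * S) n = fps_nth S k" for S :: "rat fps"
      by (simp add: Suc)
    show ?thesis
      unfolding step gf avoid_count_Suc[OF \<tau>]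
      by (simp add: avoid_gf_def fps_sum_nth fps_mult_nth)
  qed
qed

subsection \<open>Rationality\<close>

lemma rational_fps_of_poly: "rational_fps (fps_of_poly p)"
  unfolding rational_fps_def by (intro exI[of _ p] exI[of _ 1]) simp

lemma rational_fps_0: "rational_fps 0" and rational_fps_1: "rational_fps 1"
  and rational_fps_X: "rational_fps fps_X"
  using rational_fps_of_poly[of 0] rational_fps_of_poly[of 1] rational_fps_of_poly[of "[:0, 1:]"]
  by (simp_all add: fps_of_poly_pCons)

lemma rational_fps_mult:
  assumes "rational_fps F" "rational_fps G"
  shows "rational_fps (F * G)"
proof -
  obtain p q p' q' where "q \<noteq> 0" "fps_of_poly q * F = fps_of_poly p"
    "q' \<noteq> 0" "fps_of_poly q' * G = fps_of_poly p'"
    using assms unfolding rational_fps_def by blast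
  then have "q * q' \<noteq> 0" "fps_of_poly (q * q') * (F * G) = fps_of_poly (p * p')"
    by (simp_all add: fps_of_poly_mult flip: \<open>_ = fps_of_poly p\<close> \<open>_ = fps_of_poly p'\<close>)
  then show ?thesis unfolding rational_fps_def by blast
qed

lemma rational_fps_diff:
  assumes "rational_fps F" "rational_fps G"
  shows "rational_fps (F - G)"
proof -
  obtain p q p' q' where eq: "q \<noteq> 0" "fps_of_poly q * F = fps_of_poly p"
    "q' \<noteq> 0" "fps_of_poly q' * G = fps_of_poly p'"
    using assms unfolding rational_fps_def by blast
  have "fps_of_poly (q * q') * (F - G) = fps_of_poly (q' * p - q * p')"
    by (simp add: fps_of_poly_mult fps_of_poly_diff algebra_simps flip: eq(2,4))
  moreover have "q * q' \<noteq> 0" using eq by simp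
  ultimately show ?thesis unfolding rational_fps_def by blast
qed

lemma rational_fps_add:
  assumes "rational_fps F" "rational_fps G"
  shows "rational_fps (F + G)"
  using rational_fps_diff[OF assms(1) rational_fps_diff[OF rational_fps_0 assms(2)]] by simp

lemma rational_fps_sum: "(\<And>i. i \<in> I \<Longrightarrow> rational_fps (f i)) \<Longrightarrow> rational_fps (sum f I)"
  by (induction I rule: infinite_finite_induct) (auto intro: rational_fps_0 rational_fps_add)

text \<open>The denominator obtained for \<open>G\<close> contains the numerator of
  \<open>F\<close>, which is nonzero because \<open>F \<noteq> 0\<close>.\<close>

lemma rational_fps_cancel:
  assumes "rational_fps (F * G)" "rational_fps F" "F \<noteq> 0"
  shows "rational_fps G"
proof -
  obtain p q p' q' where eq: "q \<noteq> 0" "fps_of_poly q * (F * G) = fps_of_poly p"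
    "q' \<noteq> 0" "fps_of_poly q' * F = fps_of_poly p'"
    using assms unfolding rational_fps_def by blast
  have "fps_of_poly (q * p') * G = fps_of_poly (q' * p)"
    by (simp add: fps_of_poly_mult mult_ac flip: eq(2,4))
  moreover have "p' \<noteq> 0"
    using eq(3,4) assms(3) fps_of_poly_eq_iff[of q' 0] by auto
  ultimately show ?thesis using eq(1) unfolding rational_fps_def by (metis mult_eq_0_iff)
qed

text \<open>The equation reads \<open>(1 - fps_X * G) * F = H\<close>, and the factor of
  \<open>F\<close> is nonzero because its constant term is 1.\<close>

lemma rational_fps_linear:
  assumes "F = H + fps_X * G * F" "rational_fps G" "rational_fps H"
  shows "rational_fps F"
proof (rule rational_fps_cancel)
  have "(1 - fps_X * G) * F = H" using assms(1) by (simp add: algebra_simps)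
  with assms(3) show "rational_fps ((1 - fps_X * G) * F)" by simp
  show "rational_fps (1 - fps_X * G)"
    by (intro rational_fps_diff rational_fps_mult rational_fps_1 rational_fps_X assms(2))
  have "fps_nth (1 - fps_X * G) 0 = 1" by simp
  then show "1 - fps_X * G \<noteq> 0" by (metis fps_zero_nth zero_neq_one)
qed

text \<open>No square of \<open>avoid_gf \<tau>\<close> arises in the recurrence: \<sigma>^0 =
  \<tau> is multiplied by the series of \<pi>^0 only, and for r > 0 the series of \<pi>^r = \<tau>
  by that of the shorter \<sigma>^r. So the equation is linear.\<close>

lemma rational_avoid_gf:
  assumes "distinct \<tau>" "\<not> contains \<tau> [1, 3, 2]"
  shows "rational_fps (avoid_gf \<tau>)"
  using assms
proof (induction "length \<tau>" arbitrary: \<tau> rule: less_induct)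
  case less
  show ?case
  proof (cases "\<tau> = []")
    case True
    then show ?thesis by (simp add: avoid_gf_Nil rational_fps_0)
  next
    case False
    then obtain r b m where d: "canonical_decomposition \<tau> r b m"
      using canonical_decomposition_exists by blast
    have seg: "\<tau> = segment b m 0 (Suc r)"
      using d by (simp add: canonical_decomposition_def)
    \<comment> \<open>Subsequences inherit distinctness and avoidance of 132, so the induction
      hypothesis covers all shorter ones.\<close>
    have shorter: "rational_fps (avoid_gf \<rho>)" if "subseq \<rho> \<tau>" "length \<rho> < length \<tau>" for \<rho>
      using less that contains_mono subseq_distinct by blast
    have \<sigma>0: "sigma_suffix r b m 0 = \<tau>" using seg by (simp add: sigma_suffix_def)
    have \<sigma>: "rational_fps (avoid_gf (sigma_suffix r b m j))" if "0 < j" "j \<le> Suc r" for j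
    proof (rule shorter)
      have "\<tau> = segment b m 0 j @ sigma_suffix r b m j"
        unfolding seg sigma_suffix_def using that(2) by (simp add: segment_append)
      moreover have "segment b m 0 j \<noteq> []" using that(1) by (simp add: segment_Cons)
      ultimately show "subseq (sigma_suffix r b m j) \<tau>" "length (sigma_suffix r b m j) < length \<tau>"
        by (simp_all add: subseq_drop_many)
    qed
    have \<pi>0: "rational_fps (avoid_gf (b 0))"
      by (rule shorter) (simp_all add: seg segment_Cons subseq_rev_drop_many)
    have \<pi>: "rational_fps (avoid_gf (pi_prefix b m (int j)))" if "j < r" for j
    proof (cases "j = 0")
      case True
      then show ?thesis using \<pi>0 by (simp add: pi_prefix_def)
    next
      case False
      show ?thesis
      proof (rule shorter)
        have "\<tau> = pi_prefix b m (int j) @ segment b m (Suc j) (Suc r)"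
          unfolding seg using that False by (simp add: pi_prefix_def segment_append)
        moreover have "segment b m (Suc j) (Suc r) \<noteq> []" using that by (simp add: segment_Cons)
        ultimately show "subseq (pi_prefix b m (int j)) \<tau>" "length (pi_prefix b m (int j)) < length \<tau>"
          by (simp_all add: subseq_rev_drop_many)
      qed
    qed
    note rec = avoid_gf_recurrence[OF less.prems d]
    show ?thesis
    proof (cases r)
      case 0
      \<comment> \<open>Only \<open>j = 0\<close> contributes, with prefixes \<open>b 0\<close> and
        the empty one, whose series is 0.\<close>
      have "avoid_gf \<tau> = 1 + fps_X * avoid_gf (b 0) * avoid_gf \<tau>"
        using rec unfolding 0 by (simp add: pi_prefix_def avoid_gf_Nil \<sigma>0[unfolded 0] mult.assoc)
      then show ?thesis by (rule rational_fps_linear[OF _ \<pi>0 rational_fps_1])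
    next
      case (Suc s)
      define T where "T j = (avoid_gf (pi_prefix b m (int j)) - avoid_gf (pi_prefix b m (int j - 1))) *
          avoid_gf (sigma_suffix r b m j)" for j
      have T0: "T 0 = avoid_gf (b 0) * avoid_gf \<tau>"
        by (simp add: T_def pi_prefix_def avoid_gf_Nil \<sigma>0)
      \<comment> \<open>This needs \<open>r > 0\<close>, since \<pi>^0 omits
        \<open>m 0\<close>.\<close>
      have "pi_prefix b m (int r) = \<tau>" using Suc seg by (simp add: pi_prefix_def nat_add_distrib)
      then have Tr: "T r = avoid_gf \<tau> * avoid_gf (sigma_suffix r b m r) -
          avoid_gf (pi_prefix b m (int s)) * avoid_gf (sigma_suffix r b m r)"
        by (simp add: T_def Suc left_diff_distrib)
      \<comment> \<open>\<open>H\<close> collects everything without the factor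
        \<open>avoid_gf \<tau>\<close>: the middle summands and the subtracted part of
        \<open>T r\<close>.\<close>
      define H where "H = 1 + fps_X * ((\<Sum>j=1..s. T j) -
          avoid_gf (pi_prefix b m (int s)) * avoid_gf (sigma_suffix r b m r))"
      have sum: "(\<Sum>j=0..r. T j) = T 0 + (\<Sum>j=1..s. T j) + T r"
        unfolding Suc by (simp add: sum.atLeast_Suc_atMost)
      have "avoid_gf \<tau> = 1 + fps_X * (\<Sum>j=0..r. T j)"
        using rec unfolding T_def .
      also have "\<dots> = H + fps_X * (avoid_gf (b 0) + avoid_gf (sigma_suffix r b m r)) * avoid_gf \<tau>"
        unfolding sum T0 Tr H_def by (simp add: algebra_simps)
      finally have lin: "avoid_gf \<tau> =
          H + fps_X * (avoid_gf (b 0) + avoid_gf (sigma_suffix r b m r)) * avoid_gf \<tau>" .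
      have G: "rational_fps (avoid_gf (b 0) + avoid_gf (sigma_suffix r b m r))"
        using Suc by (intro rational_fps_add \<pi>0 \<sigma>) simp_all
      have "rational_fps (T j)" if "j \<in> {1..s}" for j
      proof -
        \<comment> \<open>For \<open>j \<ge> 1\<close> the index of the preceding prefix is a
          natural number, as the fact \<open>\<pi>\<close> requires.\<close>
        have pred: "int j - 1 = int (j - 1)" using that by simp
        have "j < r" "j - 1 < r" "0 < j" "j \<le> Suc r" using that Suc by auto
        then show ?thesis
          unfolding T_def pred by (intro rational_fps_mult rational_fps_diff \<pi> \<sigma>)
      qed
      moreover have "s < r" "0 < r" "r \<le> Suc r" using Suc by simp_all
      ultimately have "rational_fps H"
        unfolding H_def
        by (intro rational_fps_add rational_fps_mult rational_fps_diff rational_fps_1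
            rational_fps_X rational_fps_sum \<pi> \<sigma>) blast
      with lin G show ?thesis by (rule rational_fps_linear)
    qed
  qed
qed

theorem theorem2p1:
  fixes k r :: nat and \<tau> :: "nat list" and b :: "nat \<Rightarrow> nat list" and m :: "nat \<Rightarrow> nat"
  assumes "\<tau> \<in> avoiders k {[1, 3, 2]}"
    and "canonical_decomposition \<tau> r b m"
  shows "rational_fps (avoid_gf \<tau>) \<and>
    avoid_gf \<tau> = 1 + fps_X * (\<Sum>j=0..r.
      (avoid_gf (pi_prefix b m (int j)) - avoid_gf (pi_prefix b m (int j - 1))) * avoid_gf (sigma_suffix r b m j))"
proof -
  have "distinct \<tau>" "\<not> contains \<tau> [1, 3, 2]"
    using assms(1) by (auto simp: avoiders_def permutations_of_setD(2))
  with assms(2) show ?thesis by (blast intro: rational_avoid_gf avoid_gf_recurrence)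
qed

end
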